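(* Let $N_L$, $A_i$, $E_i$, $\tau_i$, $\mathcal{S}$ and the optimization problems $\mathcal{P}(l,k)$ be as in the context. For every $l\in\{1,\dots,N_L-1\}$ and every integer $k'\ge 0$, let $\mathbf{D}(l,k')=(D_1(l,k'),\dots,D_l(l,k'))\in\mathcal{S}^l$ be an optimal solution of $\mathcal{P}(l,k')$. Let $l\in\{1,\dots,N_L-1\}$ and let $k$ be a positive integer, and let $d'$ be an element of $$\operatorname*{arg\,min}_{d\in\mathcal{S},\ \tau_{l+1}(d)\le k}\left[\sum_{i=1}^{l} A_i E_i\bigl(D_i(l,k-\tau_{l+1}(d))\bigr)+A_{l+1}E_{l+1}(d)\right].$$ Then an optimal solution $\mathbf{D}(l+1,k)=(D_1(l+1,k),\dots,D_{l+1}(l+1,k))$ of $\mathcal{P}(l+1,k)$ is given by $$D_i(l+1,k)=D_i(l,k-\tau_{l+1}(d'))\quad\text{for each } 1\le i\le l,\qquad D_{l+1}(l+1,k)=d'.$$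
   Context: Setting. $N_L$ is a positive integer (number of layers of a neural network), and $A_1,\dots,A_{N_L}\ge 0$ are given real constants (averages over a training set of sums of squared partial derivatives of the loss with respect to the activations of layer $i$). $\mathcal{S}$ is a finite set (the degree search space) consisting of positive integers together with the extra element $-1$. For a positive integer $d$ and $1\le i\le N_L$, $E_i(d)$ is the minimum, over real polynomials $p$ of degree at most $d$, of the mean squared error $\int_{\mathbb{R}}\phi_i(x)(f(x)-p(x))^2\,dx$, where $f:\mathbb{R}\to\mathbb{R}$ is a fixed activation function and $\phi_i$ is a probability density on $\mathbb{R}$ with respect to which $f$ and all polynomials are square integrable; in particular $0\le E_i(d)<\infty$. For a positive integer $d\in\mathcal{S}$, $\tau_i(d):=\lfloor T_i(d)/\nu\rceil$, where $\nu>0$ is a fixed discretization unit, $\lfloor\cdot\rceil$ denotes rounding to the nearest integer, and $T_i$ (the runtime of layer $i$ with an approximating polynomial of degree $d$) is a positive increasing function of $d$; each $\tau_i(d)$ is assumed to be a positive integer. For the extra element, set $\tau_i(-1):=0$ and $E_i(-1):=\infty$, with the convention $A_i\cdot\infty=\infty$; sums are taken in $[0,\infty]$. For $1\le l\le N_L$ and an integer $k\ge 0$, $\mathcal{P}(l,k)$ denotes the optimization problem $$\min_{d_1,\dots,d_l\in\mathcal{S}}\ \sum_{i=1}^{l}A_iE_i(d_i)\quad\text{subject to}\quad \sum_{i=1}^{l}\tau_i(d_i)\le k.$$ An optimal solution is a vector $(d_1,\dots,d_l)\in\mathcal{S}^l$ satisfying the constraint and attaining the minimum (possibly $\infty$)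 among all vectors satisfying it. *)

theory Defs
  imports "HOL-Analysis.Analysis" "HOL-Computational_Algebra.Polynomial"
begin

section \<open>Weighted least-squares approximation by polynomials\<close>

definition prob_density :: "(real \<Rightarrow> real) \<Rightarrow> bool" where
  "prob_density \<phi> \<longleftrightarrow> \<phi> \<in> borel_measurable lebesgue \<and> (\<forall>x. 0 \<le> \<phi> x) \<and>
     integrable lebesgue \<phi> \<and> (LINT x|lebesgue. \<phi> x) = 1"

definition square_integrable_wrt :: "(real \<Rightarrow> real) \<Rightarrow> (real \<Rightarrow> real) \<Rightarrow> bool" where
  "square_integrable_wrt \<phi> g \<longleftrightarrow> g \<in> borel_measurable lebesgue \<and>
     integrable lebesgue (\<lambda>x. \<phi> x * (g x)\<^sup>2)"

definition mse :: "(real \<Rightarrow> real) \<Rightarrow> (real \<Rightarrow> real) \<Rightarrow> real poly \<Rightarrow> real" where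
  "mse f \<phi> p = (LINT x|lebesgue. \<phi> x * (f x - poly p x)\<^sup>2)"

text \<open>The minimum is a genuine one: lemma \<open>min_mse_attained\<close> below shows that it is attained.\<close>

definition min_mse :: "(real \<Rightarrow> real) \<Rightarrow> (real \<Rightarrow> real) \<Rightarrow> nat \<Rightarrow> real" where
  "min_mse f \<phi> n = (LEAST e. \<exists>p. degree p \<le> n \<and> e = mse f \<phi> p)"

lemma square_integrable_wrt_mult:
  assumes "prob_density \<phi>" "square_integrable_wrt \<phi> g" "square_integrable_wrt \<phi> h"
  shows "integrable lebesgue (\<lambda>x. \<phi> x * (g x * h x))"
proof (rule Bochner_Integration.integrable_bound)
  show "integrable lebesgue (\<lambda>x. \<phi> x * (g x)\<^sup>2 + \<phi> x * (h x)\<^sup>2)"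
    using assms unfolding square_integrable_wrt_def
    by (intro Bochner_Integration.integrable_add) blast+
  show "(\<lambda>x. \<phi> x * (g x * h x)) \<in> borel_measurable lebesgue"
    using assms unfolding square_integrable_wrt_def prob_density_def
    by (intro borel_measurable_times) blast+
  have "\<bar>a * b\<bar> \<le> a\<^sup>2 + b\<^sup>2" for a b :: real
  proof -
    have "2 * (\<bar>a\<bar> * \<bar>b\<bar>) \<le> a\<^sup>2 + b\<^sup>2"
      using sum_squares_bound[of "\<bar>a\<bar>" "\<bar>b\<bar>"] unfolding power2_abs mult.assoc .
    moreover have "0 \<le> \<bar>a\<bar> * \<bar>b\<bar>"
      by (intro mult_nonneg_nonneg abs_ge_zero)
    ultimately show ?thesis unfolding abs_mult by linarith
  qed
  then have le: "\<bar>g x * h x\<bar> \<le> (g x)\<^sup>2 + (h x)\<^sup>2" for x .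
  have "norm (\<phi> x * (g x * h x)) \<le> norm (\<phi> x * (g x)\<^sup>2 + \<phi> x * (h x)\<^sup>2)" for x
  proof -
    have "0 \<le> \<phi> x"
      using assms(1) by (simp add: prob_density_def)
    then have "norm (\<phi> x * (g x * h x)) = \<phi> x * \<bar>g x * h x\<bar>"
      by (simp only: real_norm_def abs_mult[of "\<phi> x"] abs_of_nonneg)
    also have "\<dots> \<le> \<phi> x * ((g x)\<^sup>2 + (h x)\<^sup>2)"
      by (rule mult_left_mono[OF le \<open>0 \<le> \<phi> x\<close>])
    also have "\<dots> \<le> norm (\<phi> x * (g x)\<^sup>2 + \<phi> x * (h x)\<^sup>2)"
      unfolding distrib_left real_norm_def by (rule abs_ge_self)
    finally show ?thesis .
  qed
  then show "AE x in lebesgue. norm (\<phi> x * (g x * h x)) \<le> norm (\<phi> x * (g x)\<^sup>2 + \<phi> x * (h x)\<^sup>2)"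
    by (rule AE_I2)
qed

lemma square_integrable_wrt_lincomb:
  assumes "prob_density \<phi>" "square_integrable_wrt \<phi> g" "square_integrable_wrt \<phi> h"
  shows "square_integrable_wrt \<phi> (\<lambda>x. g x + c * h x)"
proof -
  have "integrable lebesgue (\<lambda>x. \<phi> x * (g x)\<^sup>2 + 2 * c * (\<phi> x * (g x * h x)) + c\<^sup>2 * (\<phi> x * (h x)\<^sup>2))"
    by (rule Bochner_Integration.integrable_add[OF Bochner_Integration.integrable_add])
       (use assms square_integrable_wrt_mult[OF assms] in
         \<open>simp_all only: square_integrable_wrt_def integrable_mult_right\<close>)
  moreover have "(\<lambda>x. \<phi> x * (g x)\<^sup>2 + 2 * c * (\<phi> x * (g x * h x)) + c\<^sup>2 * (\<phi> x * (h x)\<^sup>2))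
      = (\<lambda>x. \<phi> x * (g x + c * h x)\<^sup>2)"
    by (intro ext) algebra
  ultimately show ?thesis
    using assms unfolding square_integrable_wrt_def by auto
qed

lemma orthogonal_to_null:
  assumes "prob_density \<phi>" "square_integrable_wrt \<phi> g" "square_integrable_wrt \<phi> w"
    and "(LINT x|lebesgue. \<phi> x * (w x)\<^sup>2) = 0"
  shows "(LINT x|lebesgue. \<phi> x * (g x * w x)) = 0"
proof -
  have "AE x in lebesgue. \<phi> x * (w x)\<^sup>2 = 0"
    using assms integral_nonneg_eq_0_iff_AE[of lebesgue "\<lambda>x. \<phi> x * (w x)\<^sup>2"]
    unfolding square_integrable_wrt_def prob_density_def by auto
  then have "AE x in lebesgue. \<phi> x * (g x * w x) = 0"
    by (rule AE_mp) auto
  then show ?thesis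
    by (rule integral_eq_zero_AE)
qed

lemma polynomial_projection_exists:
  assumes phi: "prob_density \<phi>"
    and polys: "\<And>p :: real poly. square_integrable_wrt \<phi> (poly p)"
    and "square_integrable_wrt \<phi> g"
  shows "\<exists>p. (\<forall>i\<ge>n. coeff p i = 0) \<and>
     (\<forall>q. (\<forall>i\<ge>n. coeff q i = 0) \<longrightarrow> (LINT x|lebesgue. \<phi> x * ((g x - poly p x) * poly q x)) = 0)"
  using assms(3)
proof (induction n arbitrary: g)
  case 0
  have "q = 0" if "\<forall>i\<ge>0. coeff q i = 0" for q :: "real poly"
    using that by (intro poly_eqI) simp
  then have "(LINT x|lebesgue. \<phi> x * ((g x - poly 0 x) * poly q x)) = 0"
    if "\<forall>i\<ge>0. coeff q i = 0" for q :: "real poly"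
    using that by fastforce
  then show ?case by (intro exI[of _ 0] conjI allI impI) (simp, blast)
next
  case (Suc n)
  define u :: "real poly" where "u = monom 1 n"
  obtain r where r: "\<forall>i\<ge>n. coeff r i = 0"
    "\<And>q. \<forall>i\<ge>n. coeff q i = 0 \<Longrightarrow> (LINT x|lebesgue. \<phi> x * ((g x - poly r x) * poly q x)) = 0"
    using Suc by blast
  obtain v where v: "\<forall>i\<ge>n. coeff v i = 0"
    "\<And>q. \<forall>i\<ge>n. coeff q i = 0 \<Longrightarrow> (LINT x|lebesgue. \<phi> x * ((poly u x - poly v x) * poly q x)) = 0"
    using Suc.IH[OF polys[of u]] by blast
  define w where "w = u - v"
  have gr: "square_integrable_wrt \<phi> (\<lambda>x. g x - poly r x)"
    using square_integrable_wrt_lincomb[OF phi Suc.prems polys[of r], of "-1"] by simp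
  define N where "N = (LINT x|lebesgue. \<phi> x * (poly w x)\<^sup>2)"
  define I where "I = (LINT x|lebesgue. \<phi> x * ((g x - poly r x) * poly w x))"
  define c where "c = (if N = 0 then 0 else I / N)"
  have I: "I = c * N"
    using orthogonal_to_null[OF phi gr polys[of w]] by (auto simp: c_def N_def I_def)
  have int1: "integrable lebesgue (\<lambda>x. \<phi> x * ((g x - poly r x) * poly q x))" for q
    using square_integrable_wrt_mult[OF phi gr polys] .
  have int2: "integrable lebesgue (\<lambda>x. \<phi> x * (poly p x * poly q x))" for p q
    using square_integrable_wrt_mult[OF phi polys polys] .
  show ?case
  proof (intro exI[of _ "r + smult c w"] conjI allI impI)
    show "coeff (r + smult c w) i = 0" if "Suc n \<le> i" for i
      using that r(1) v(1) by (auto simp: w_def u_def)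
    fix q :: "real poly" assume q: "\<forall>i\<ge>Suc n. coeff q i = 0"
    define b where "b = coeff q n"
    define s where "s = q - smult b w"
    have s: "\<forall>i\<ge>n. coeff s i = 0"
    proof (intro allI impI)
      show "coeff s i = 0" if "n \<le> i" for i
        using that q v(1) by (cases "i = n") (auto simp: s_def b_def w_def u_def)
    qed
    have ws: "(LINT x|lebesgue. \<phi> x * (poly w x * poly s x)) = 0"
      using v(2)[OF s] by (simp add: w_def)
    have "(LINT x|lebesgue. \<phi> x * ((g x - poly (r + smult c w) x) * poly q x)) =
      (LINT x|lebesgue. \<phi> x * ((g x - poly r x) * poly s x) + b * (\<phi> x * ((g x - poly r x) * poly w x))
         - (c * (\<phi> x * (poly w x * poly s x)) + c * b * (\<phi> x * (poly w x * poly w x))))"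
    proof (rule Bochner_Integration.integral_cong[OF refl])
      fix x
      have "poly q x = poly s x + b * poly w x"
        by (simp add: s_def)
      then show "\<phi> x * ((g x - poly (r + smult c w) x) * poly q x) =
        \<phi> x * ((g x - poly r x) * poly s x) + b * (\<phi> x * ((g x - poly r x) * poly w x))
         - (c * (\<phi> x * (poly w x * poly s x)) + c * b * (\<phi> x * (poly w x * poly w x)))"
        unfolding poly_add poly_smult by algebra
    qed
    also have "\<dots> = 0 + b * I - (c * 0 + c * b * N)"
      unfolding Bochner_Integration.integral_diff[OF
          Bochner_Integration.integrable_add[OF int1[of s] integrable_mult_right[OF int1[of w]]]
          Bochner_Integration.integrable_add[OF integrable_mult_right[OF int2[of w s]]
            integrable_mult_right[OF int2[of w w]]]]
        Bochner_Integration.integral_add[OF int1[of s] integrable_mult_right[OF int1[of w]]]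
        Bochner_Integration.integral_add[OF integrable_mult_right[OF int2[of w s]]
            integrable_mult_right[OF int2[of w w]]]
        integral_mult_right_zero r(2)[OF s] ws I_def N_def power2_eq_square ..
    also have "\<dots> = 0"
      by (simp add: I)
    finally show "(LINT x|lebesgue. \<phi> x * ((g x - poly (r + smult c w) x) * poly q x)) = 0" .
  qed
qed

lemma min_mse_attained:
  assumes phi: "prob_density \<phi>"
    and polys: "\<And>p :: real poly. square_integrable_wrt \<phi> (poly p)"
    and f: "square_integrable_wrt \<phi> f"
  shows "\<exists>p. degree p \<le> n \<and> min_mse f \<phi> n = mse f \<phi> p \<and>
           (\<forall>q. degree q \<le> n \<longrightarrow> mse f \<phi> p \<le> mse f \<phi> q)"
proof -
  have deg: "degree q \<le> n \<longleftrightarrow> (\<forall>i\<ge>Suc n. coeff q i = 0)" for q :: "real poly"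
    using degree_le[of n q] coeff_eq_0[of q] by (auto simp: Suc_le_eq)
  obtain p where p: "degree p \<le> n"
    "\<And>q. degree q \<le> n \<Longrightarrow> (LINT x|lebesgue. \<phi> x * ((f x - poly p x) * poly q x)) = 0"
    using polynomial_projection_exists[OF assms, of "Suc n"] unfolding deg by blast
  have fp: "square_integrable_wrt \<phi> (\<lambda>x. f x - poly p x)"
    using square_integrable_wrt_lincomb[OF phi f polys[of p], of "-1"] by simp
  have le: "mse f \<phi> p \<le> mse f \<phi> q" if q: "degree q \<le> n" for q
  proof -
    define s where "s = p - q"
    have s: "degree s \<le> n" unfolding s_def using p(1) q by (rule degree_diff_le)
    have "mse f \<phi> q = (LINT x|lebesgue. \<phi> x * (f x - poly p x)\<^sup>2
        + 2 * (\<phi> x * ((f x - poly p x) * poly s x)) + \<phi> x * (poly s x)\<^sup>2)"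
      unfolding mse_def
      by (rule Bochner_Integration.integral_cong) (auto simp: s_def power2_eq_square algebra_simps)
    also have "\<dots> = mse f \<phi> p + 2 * 0 + (LINT x|lebesgue. \<phi> x * (poly s x)\<^sup>2)"
      using fp polys[of s] square_integrable_wrt_mult[OF phi fp polys[of s]] p(2)[OF s]
      unfolding mse_def square_integrable_wrt_def by simp
    also have "\<dots> \<ge> mse f \<phi> p"
      using phi by (simp add: prob_density_def)
    finally show ?thesis .
  qed
  have "min_mse f \<phi> n = mse f \<phi> p"
    unfolding min_mse_def using p(1) le by (intro Least_equality) auto
  then show ?thesis using p(1) le by blast
qed

section \<open>Layerwise error and discretized runtime\<close>

text \<open>The index \<open>i\<close> of a layer ranges over \<open>1, \<dots>, N\<^sub>L\<close>.  An element \<open>d\<close> of the search space is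
  either a degree \<open>d > 0\<close> or the extra element \<open>-1\<close>.\<close>

definition approx_error ::
    "(real \<Rightarrow> real) \<Rightarrow> (nat \<Rightarrow> real \<Rightarrow> real) \<Rightarrow> nat \<Rightarrow> int \<Rightarrow> ennreal" where
  "approx_error f \<phi> i d = (if d = -1 then \<infinity> else ennreal (min_mse f (\<phi> i) (nat d)))"

text \<open>In \<^typ>\<open>ennreal\<close> one has \<open>0 * \<infinity> = 0\<close>, but here \<open>A\<^sub>i * \<infinity>\<close> is \<open>\<infinity>\<close> even if \<open>A\<^sub>i = 0\<close>.\<close>

definition layer_cost ::
    "(nat \<Rightarrow> real) \<Rightarrow> (real \<Rightarrow> real) \<Rightarrow> (nat \<Rightarrow> real \<Rightarrow> real) \<Rightarrow> nat \<Rightarrow> int \<Rightarrow> ennreal" where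
  "layer_cost A f \<phi> i d =
     (if approx_error f \<phi> i d = \<infinity> then \<infinity> else ennreal (A i) * approx_error f \<phi> i d)"

definition disc_time :: "(nat \<Rightarrow> int \<Rightarrow> real) \<Rightarrow> real \<Rightarrow> nat \<Rightarrow> int \<Rightarrow> int" where
  "disc_time T \<nu> i d = (if d = -1 then 0 else round (T i d / \<nu>))"

section \<open>The optimization problems\<close>

text \<open>A vector \<open>(d\<^sub>1, \<dots>, d\<^sub>l)\<close> over \<open>S\<close> is an extensional function on \<open>{1..l}\<close>.\<close>

definition feasible ::
    "int set \<Rightarrow> (nat \<Rightarrow> int \<Rightarrow> real) \<Rightarrow> real \<Rightarrow> nat \<Rightarrow> int \<Rightarrow> (nat \<Rightarrow> int) \<Rightarrow> bool" where
  "feasible S T \<nu> l k d \<longleftrightarrow>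
     d \<in> {1..l} \<rightarrow>\<^sub>E S \<and> (\<Sum>i = 1..l. disc_time T \<nu> i (d i)) \<le> k"

definition total_cost ::
    "(nat \<Rightarrow> real) \<Rightarrow> (real \<Rightarrow> real) \<Rightarrow> (nat \<Rightarrow> real \<Rightarrow> real) \<Rightarrow> nat \<Rightarrow> (nat \<Rightarrow> int) \<Rightarrow> ennreal" where
  "total_cost A f \<phi> l d = (\<Sum>i = 1..l. layer_cost A f \<phi> i (d i))"

definition optimal_solution ::
    "(nat \<Rightarrow> real) \<Rightarrow> (real \<Rightarrow> real) \<Rightarrow> (nat \<Rightarrow> real \<Rightarrow> real) \<Rightarrow> int set \<Rightarrow>
     (nat \<Rightarrow> int \<Rightarrow> real) \<Rightarrow> real \<Rightarrow> nat \<Rightarrow> int \<Rightarrow> (nat \<Rightarrow> int) \<Rightarrow> bool" where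
  "optimal_solution A f \<phi> S T \<nu> l k d \<longleftrightarrow>
     is_arg_min (total_cost A f \<phi> l) (feasible S T \<nu> l k) d"

end

theory Submission
  imports Defs
begin

text \<open>The constraint and the objective of \<open>\<P>(l + 1, k)\<close> split off the last layer: fixing its degree
  \<open>d\<close> leaves \<open>\<P>(l, k - \<tau> d)\<close> for the others. Runtimes are nonnegative, so every feasible vector
  has \<open>\<tau> d \<le> k\<close>, and the last degree of a feasible vector is among the candidates for \<open>d'\<close>.\<close>

lemma disc_time_nonneg:
  assumes "d = -1 \<or> 0 < d" and "0 < d \<Longrightarrow> 0 < disc_time T \<nu> i d"
  shows "0 \<le> disc_time T \<nu> i d"
  using assms by (auto simp: disc_time_def)

text \<open>\<open>restrict d {1..l}\<close> is extensional whatever \<open>d\<close> is, so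
  feasibility of the restriction says nothing about \<open>d\<close> outside
  \<open>{1..Suc l}\<close>; the conjunct on \<open>extensional\<close> supplies this.\<close>

lemma feasible_Suc:
  "feasible S T \<nu> (Suc l) k d \<longleftrightarrow> d \<in> extensional {1..Suc l} \<and> d (Suc l) \<in> S \<and>
     feasible S T \<nu> l (k - disc_time T \<nu> (Suc l) (d (Suc l))) (restrict d {1..l})"
  unfolding feasible_def by (auto simp: PiE_iff atLeastAtMostSuc_conv simp del: One_nat_def)

lemma total_cost_Suc:
  "total_cost A f \<phi> (Suc l) d =
     total_cost A f \<phi> l (restrict d {1..l}) + layer_cost A f \<phi> (Suc l) (d (Suc l))"
  by (simp add: total_cost_def)

text \<open>Applied to the budget left over by the last layer: it shows that the last degree of a
  feasible vector competes with \<open>d'\<close>.\<close>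

lemma feasible_imp_nonneg:
  assumes "feasible S T \<nu> l k d" and "\<And>i x. i \<in> {1..l} \<Longrightarrow> x \<in> S \<Longrightarrow> 0 \<le> disc_time T \<nu> i x"
  shows "0 \<le> k"
proof -
  have "0 \<le> (\<Sum>i = 1..l. disc_time T \<nu> i (d i))"
    using assms by (intro sum_nonneg) (auto simp: feasible_def PiE_iff)
  then show ?thesis
    using assms(1) by (simp add: feasible_def)
qed

theorem theorem2:
  fixes N_L l :: nat and k :: int and A :: "nat \<Rightarrow> real" and S :: "int set"
    and f :: "real \<Rightarrow> real" and \<phi> :: "nat \<Rightarrow> real \<Rightarrow> real"
    and T :: "nat \<Rightarrow> int \<Rightarrow> real" and \<nu> :: real
    and D :: "nat \<Rightarrow> int \<Rightarrow> nat \<Rightarrow> int" and d' :: int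
  assumes "1 \<le> N_L"
    and "\<And>i. i \<in> {1..N_L} \<Longrightarrow> 0 \<le> A i"
    and "finite S" and "-1 \<in> S" and "\<And>d. d \<in> S \<Longrightarrow> d = -1 \<or> 0 < d"
    and "\<And>i. i \<in> {1..N_L} \<Longrightarrow> prob_density (\<phi> i)"
    and "\<And>i. i \<in> {1..N_L} \<Longrightarrow> square_integrable_wrt (\<phi> i) f"
    and "\<And>i p. i \<in> {1..N_L} \<Longrightarrow> square_integrable_wrt (\<phi> i) (poly p)"
    and "0 < \<nu>"
    and "\<And>i d. i \<in> {1..N_L} \<Longrightarrow> d \<in> S \<Longrightarrow> 0 < d \<Longrightarrow> 0 < T i d"
    and "\<And>i. i \<in> {1..N_L} \<Longrightarrow> mono_on {d \<in> S. 0 < d} (T i)"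
    and "\<And>i d. i \<in> {1..N_L} \<Longrightarrow> d \<in> S \<Longrightarrow> 0 < d \<Longrightarrow> 0 < disc_time T \<nu> i d"
    and D: "\<And>l k'. l \<in> {1..N_L - 1} \<Longrightarrow> 0 \<le> k' \<Longrightarrow>
          optimal_solution A f \<phi> S T \<nu> l k' (D l k')"
    and "l \<in> {1..N_L - 1}" and "0 < k"
    and d': "is_arg_min
          (\<lambda>d. (\<Sum>i = 1..l. layer_cost A f \<phi> i (D l (k - disc_time T \<nu> (l + 1) d) i))
                + layer_cost A f \<phi> (l + 1) d)
          (\<lambda>d. d \<in> S \<and> disc_time T \<nu> (l + 1) d \<le> k) d'"
  shows "optimal_solution A f \<phi> S T \<nu> (l + 1) k
          (\<lambda>i\<in>{1..l + 1}. if i \<le> l then D l (k - disc_time T \<nu> (l + 1) d') i else d')"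
proof -
  have nonneg: "0 \<le> disc_time T \<nu> i d" if "i \<in> {1..N_L}" "d \<in> S" for i d
    using assms(5,12) that by (intro disc_time_nonneg) auto
  \<comment> \<open>\<open>C\<close> is the objective that \<open>d'\<close> minimizes, and
    \<open>0 \<le> r d\<close> is its constraint on \<open>d\<close>.\<close>
  define r where "r d = k - disc_time T \<nu> (Suc l) d" for d
  define C where "C d = total_cost A f \<phi> l (D l (r d)) + layer_cost A f \<phi> (Suc l) d" for d
  have opt: "feasible S T \<nu> l k' (D l k')"
      "\<And>e. feasible S T \<nu> l k' e \<Longrightarrow> total_cost A f \<phi> l (D l k') \<le> total_cost A f \<phi> l e"
    if "0 \<le> k'" for k'
    using D[OF assms(14) that] unfolding optimal_solution_def is_arg_min_linorder by auto
  have d'S: "d' \<in> S" "0 \<le> r d'" and d'_min: "\<And>d. d \<in> S \<Longrightarrow> 0 \<le> r d \<Longrightarrow> C d' \<le> C d"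
    using d' unfolding is_arg_min_linorder C_def r_def total_cost_def by auto
  define e' where "e' = (\<lambda>i\<in>{1..Suc l}. if i \<le> l then D l (r d') i else d')"
  \<comment> \<open>Equality of functions: \<open>D l (r d')\<close> is feasible, hence extensional,
    so both sides are \<open>undefined\<close> outside \<open>{1..l}\<close>.\<close>
  have "restrict e' {1..l} = D l (r d')"
    using opt(1)[OF d'S(2)] by (auto simp: e'_def feasible_def PiE_iff extensional_def fun_eq_iff)
  moreover have "e' (Suc l) = d'" "e' \<in> extensional {1..Suc l}"
    by (simp_all add: e'_def)
  ultimately have e': "feasible S T \<nu> (Suc l) k e'" "total_cost A f \<phi> (Suc l) e' = C d'"
    using opt(1)[OF d'S(2)] d'S(1) by (simp_all add: feasible_Suc total_cost_Suc C_def r_def)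
  have "C d' \<le> total_cost A f \<phi> (Suc l) e" if "feasible S T \<nu> (Suc l) k e" for e
  proof -
    have e: "e (Suc l) \<in> S" "feasible S T \<nu> l (r (e (Suc l))) (restrict e {1..l})"
      using that by (simp_all add: feasible_Suc r_def)
    \<comment> \<open>Needed twice: \<open>D l k'\<close> is optimal only for
      \<open>0 \<le> k'\<close>, and \<open>d'\<close> is compared only with degrees that fit into
      the budget.\<close>
    have r_nonneg: "0 \<le> r (e (Suc l))"
      using e(2) by (rule feasible_imp_nonneg) (use nonneg assms(14) in auto)
    have "C d' \<le> C (e (Suc l))"
      by (rule d'_min[OF e(1) r_nonneg])
    \<comment> \<open>Exchange: replacing the first \<open>l\<close> degrees of \<open>e\<close> by
      the optimal ones for the same remaining budget does not raise the cost. Monotonicity of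
      addition suffices, so infinite costs need no separate case.\<close>
    also have "\<dots> \<le> total_cost A f \<phi> (Suc l) e"
      unfolding C_def total_cost_Suc by (rule add_right_mono[OF opt(2)[OF r_nonneg e(2)]])
    finally show ?thesis .
  qed
  then have "optimal_solution A f \<phi> S T \<nu> (Suc l) k e'"
    using e' by (simp add: optimal_solution_def is_arg_min_linorder)
  then show ?thesis
    unfolding e'_def r_def Suc_eq_plus1 .
qed

end
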